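(* Let $\mathfrak F$ be a real normed division algebra of real dimension $\beta\in\{1,2,4,8\}$, let $m,n$ be positive integers and $\nu>0$ real. Let $S>0$ be a random variable with $S\sim\chi^{2,\beta}(\nu)$, independent of $\mathbf Y\sim\mathcal N_{m\times n}^\beta(\mathbf 0,\mathbf I_m\otimes\mathbf I_n)$. Define $S_1=S+\mathrm{tr}\,\mathbf Y\mathbf Y^*$ and $\mathbf R_1=S_1^{-1/2}\mathbf Y$. Then $S_1\sim\chi^{2,\beta}(\nu+mn)$ and $S_1$ is independent of $\mathbf R_1$. Furthermore, $\mathbf R_1$ has density $$\frac{\Gamma[\beta(\nu+mn)/2]}{\pi^{\beta mn/2}\,\Gamma[\beta\nu/2]}\,(1-\mathrm{tr}\,\mathbf R_1\mathbf R_1^* )^{\beta\nu/2-1},\qquad 1-\mathrm{tr}\,\mathbf R_1\mathbf R_1^*>0,$$ on $\mathfrak F^{m\times n}$ (and density $0$ elsewhere).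
   Context: $\mathfrak F$ is one of the reals, complex numbers, quaternions, octonions; $\beta=1,2,4,8$ respectively is its real dimension. $\mathbf A^*$ is the conjugate transpose. Densities on $\mathfrak F^{m\times n}$ are with respect to Lebesgue measure in the $\beta mn$ real coordinates of the entries. $S\sim\chi^{2,\beta}(\nu)$ means $S$ has density proportional to $s^{\beta\nu/2-1}e^{-\beta s/2}$ on $s>0$. $\mathbf Y\sim\mathcal N_{m\times n}^\beta(\mathbf 0,\mathbf I_m\otimes\mathbf I_n)$ means $\mathbf Y\in\mathfrak F^{m\times n}$ has density $(2\pi\beta^{-1})^{-\beta mn/2}\exp\{-\beta\,\mathrm{tr}(\mathbf Y\mathbf Y^* )/2\}$. The distribution with the density of $\mathbf R_1$ in the claim is called the matrix multivariate Pearson type II distribution. *)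

theory Defs
  imports "HOL-Probability.Probability"
begin

section \<open>Real normed division algebras\<close>

text \<open>
  A real normed division algebra: a unital, not necessarily commutative or associative,
  finite-dimensional real algebra with a multiplicative norm. The norm is the Euclidean norm of the
  underlying \<open>euclidean_space\<close>, as it is in the reals, complex numbers, quaternions and
  octonions; its dimension is \<open>DIM('f)\<close>. All four algebras are shown below to be
  instances. The multiplication is an explicit parameter because neither quaternions nor octonions
  can be instances of \<open>real_normed_field\<close>, and octonions are not even a ring in the sense
  of the type classes.
\<close>

locale normed_division_algebra =
  fixes mul :: "'f::euclidean_space \<Rightarrow> 'f \<Rightarrow> 'f" and one :: 'f
  assumes bilinear_mul: "bilinear mul"
    and mul_one_left: "mul one x = x"
    and mul_one_right: "mul x one = x"
    and norm_mul: "norm (mul x y) = norm x * norm y"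

text \<open>The real part is the coordinate along the unit; conjugation fixes the unit and negates its
  orthogonal complement, the imaginary elements.\<close>

definition re_part :: "'f::euclidean_space \<Rightarrow> 'f \<Rightarrow> real" where
  "re_part one x = x \<bullet> one"

definition nda_conj :: "'f::euclidean_space \<Rightarrow> 'f \<Rightarrow> 'f" where
  "nda_conj one x = (2 * re_part one x) *\<^sub>R one - x"


section \<open>Matrices\<close>

text \<open>
  An \<open>m \<times> n\<close> matrix over the algebra has type \<open>'f^'n^'m\<close> with
  \<open>m = CARD('m)\<close> and \<open>n = CARD('n)\<close>. This type is again a
  \<open>euclidean_space\<close>, whose basis consists of the matrices with a single nonzero entry,
  that entry being a basis element of \<open>'f\<close>; so \<open>lborel\<close> on it is Lebesgue
  measure in the \<open>\<beta> m n\<close> real coordinates of the entries. The library's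
  \<open>**\<close> and \<open>trace\<close> require semiring entries and are therefore restated.
\<close>

definition mat_mul :: "('f::euclidean_space \<Rightarrow> 'f \<Rightarrow> 'f) \<Rightarrow> 'f^'n^'m \<Rightarrow> 'f^'k^'n \<Rightarrow> 'f^'k^'m" where
  "mat_mul mul A B = (\<chi> i j. \<Sum>k\<in>UNIV. mul (A $ i $ k) (B $ k $ j))"

definition conj_transpose :: "'f::euclidean_space \<Rightarrow> 'f^'n^'m \<Rightarrow> 'f^'m^'n" where
  "conj_transpose one A = (\<chi> i j. nda_conj one (A $ j $ i))"

definition mat_trace :: "'f::euclidean_space^'n^'n \<Rightarrow> 'f" where
  "mat_trace A = (\<Sum>i\<in>UNIV. A $ i $ i)"

text \<open>The trace of \<open>A A\<^sup>*\<close> is a real multiple of the unit (shown below in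
  \<open>mat_trace_mul_conj_transpose\<close>); taking the real part only turns it into an element of
  type \<open>real\<close>.\<close>

definition tr_AAstar :: "('f::euclidean_space \<Rightarrow> 'f \<Rightarrow> 'f) \<Rightarrow> 'f \<Rightarrow> 'f^'n^'m \<Rightarrow> real" where
  "tr_AAstar mul one A = re_part one (mat_trace (mat_mul mul A (conj_transpose one A)))"


section \<open>Distributions\<close>

definition chi2_distributed :: "'a measure \<Rightarrow> ('a \<Rightarrow> real) \<Rightarrow> nat \<Rightarrow> real \<Rightarrow> bool" where
  "chi2_distributed M S \<beta> \<nu> \<longleftrightarrow>
     (\<exists>c>0. distributed M lborel S (\<lambda>s. ennreal
        (if s > 0 then c * (s powr (real \<beta> * \<nu> / 2 - 1) * exp (- real \<beta> * s / 2)) else 0)))"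

text \<open>In the next definition the algebra has real dimension \<open>\<beta> = DIM('f)\<close>.\<close>

definition std_matrix_normal_distributed ::
  "('f::euclidean_space \<Rightarrow> 'f \<Rightarrow> 'f) \<Rightarrow> 'f \<Rightarrow> 'a measure \<Rightarrow> ('a \<Rightarrow> 'f^'n^'m) \<Rightarrow> bool" where
  "std_matrix_normal_distributed mul one M Y \<longleftrightarrow>
     (let \<beta> = real DIM('f); m = real CARD('m); n = real CARD('n) in
      distributed M lborel Y (\<lambda>A. ennreal
        ((2 * pi * \<beta> powr (-1)) powr (- \<beta> * m * n / 2) * exp (- \<beta> * tr_AAstar mul one A / 2))))"

text \<open>Independence of two random variables. The library's \<open>indep_var\<close> requires both
  variables to take values in the same type; this is its characterisation \<open>indep_var_eq\<close>
  in terms of the generated sigma-algebras, for value types that may differ.\<close>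

definition independent_rvs ::
  "'a measure \<Rightarrow> 'b measure \<Rightarrow> ('a \<Rightarrow> 'b) \<Rightarrow> 'c measure \<Rightarrow> ('a \<Rightarrow> 'c) \<Rightarrow> bool" where
  "independent_rvs M N1 X1 N2 X2 \<longleftrightarrow>
     X1 \<in> measurable M N1 \<and> X2 \<in> measurable M N2 \<and>
     prob_space.indep_set M {X1 -` A \<inter> space M |A. A \<in> sets N1} {X2 -` B \<inter> space M |B. B \<in> sets N2}"


section \<open>The trace of \<open>A A\<^sup>*\<close> is real\<close>

context normed_division_algebra
begin

lemmas mul_simps =
  bilinear_ladd[OF bilinear_mul] bilinear_radd[OF bilinear_mul]
  bilinear_lmul[OF bilinear_mul] bilinear_rmul[OF bilinear_mul]
  bilinear_lsub[OF bilinear_mul] bilinear_rsub[OF bilinear_mul]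
  bilinear_lneg[OF bilinear_mul] bilinear_rneg[OF bilinear_mul]

lemma norm_one: "norm one = 1"
proof -
  obtain b :: 'f where "b \<in> Basis" using nonempty_Basis by blast
  then show ?thesis using norm_mul[of one b] by (simp add: mul_one_left)
qed

lemma one_inner_one: "one \<bullet> one = 1"
  using norm_one by (simp add: norm_eq_1)

lemma inner_mul_same: "mul x y \<bullet> mul x y = (x \<bullet> x) * (y \<bullet> y)"
  by (simp add: dot_square_norm norm_mul power_mult_distrib)

lemma inner_mul_left: "mul x y \<bullet> mul x z = (x \<bullet> x) * (y \<bullet> z)"
  using inner_mul_same[of x "y + z"]
  by (simp add: inner_mul_same mul_simps inner_add inner_commute algebra_simps)

lemma inner_mul_right: "mul x y \<bullet> mul z y = (x \<bullet> z) * (y \<bullet> y)"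
  using inner_mul_same[of "x + z" y]
  by (simp add: inner_mul_same mul_simps inner_add inner_commute algebra_simps)

lemma inner_mul_exchange: "mul x y \<bullet> mul z w + mul x w \<bullet> mul z y = 2 * (x \<bullet> z) * (y \<bullet> w)"
  using inner_mul_right[of x "y + w" z]
  by (simp add: inner_mul_right mul_simps inner_add inner_commute algebra_simps)

lemma inner_mul_conj_right: "mul x y \<bullet> z = x \<bullet> mul z (nda_conj one y)"
  using inner_mul_exchange[of x y z one]
  by (simp add: nda_conj_def re_part_def mul_simps mul_one_right inner_diff algebra_simps)

lemma inner_mul_conj_left: "mul x y \<bullet> z = y \<bullet> mul (nda_conj one x) z"
  using inner_mul_exchange[of x y one z]
  by (simp add: nda_conj_def re_part_def mul_simps mul_one_left inner_diff inner_commute algebra_simps)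

lemma conj_conj: "nda_conj one (nda_conj one x) = x"
  by (simp add: nda_conj_def re_part_def inner_diff one_inner_one algebra_simps)

lemma norm_conj: "norm (nda_conj one x) = norm x"
  unfolding norm_eq
  by (simp add: nda_conj_def re_part_def inner_diff one_inner_one inner_commute algebra_simps)

lemma mul_conj: "mul x (nda_conj one x) = (x \<bullet> x) *\<^sub>R one"
proof (rule vector_eq_rdot[THEN iffD1], rule allI)
  fix z
  have "mul x (nda_conj one x) \<bullet> z = mul one x \<bullet> mul z x"
    by (simp add: inner_mul_conj_right conj_conj mul_one_left)
  also have "\<dots> = (x \<bullet> x) *\<^sub>R one \<bullet> z"
    by (simp only: inner_mul_right) simp
  finally show "mul x (nda_conj one x) \<bullet> z = (x \<bullet> x) *\<^sub>R one \<bullet> z" .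
qed

lemma mat_trace_mul_conj_transpose:
  fixes A :: "'f^'n^'m"
  shows "mat_trace (mat_mul mul A (conj_transpose one A)) = (norm A)\<^sup>2 *\<^sub>R one"
  by (simp add: mat_trace_def mat_mul_def conj_transpose_def mul_conj inner_vec_def
      flip: scaleR_sum_left power2_norm_eq_inner)
     (simp add: power2_norm_eq_inner inner_vec_def)

lemma tr_AAstar_eq: "tr_AAstar mul one A = (norm A)\<^sup>2"
  by (simp add: tr_AAstar_def mat_trace_mul_conj_transpose re_part_def one_inner_one)

end


section \<open>The four algebras\<close>

interpretation real_nda: normed_division_algebra "(*)" "1::real"
  by unfold_locales (auto simp: bilinear_times abs_mult)

interpretation complex_nda: normed_division_algebra "(*)" "1::complex"
  by unfold_locales (auto simp: bilinear_times norm_mult)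

text \<open>The Cayley--Dickson double of an algebra. Doubling the complex numbers gives the quaternions,
  doubling those gives the octonions.\<close>

definition cd_mul :: "('f::euclidean_space \<Rightarrow> 'f \<Rightarrow> 'f) \<Rightarrow> 'f \<Rightarrow> 'f \<times> 'f \<Rightarrow> 'f \<times> 'f \<Rightarrow> 'f \<times> 'f" where
  "cd_mul mul one = (\<lambda>(a, b) (c, d).
     (mul a c - mul (nda_conj one d) b, mul d a + mul b (nda_conj one c)))"

definition cd_one :: "'f::euclidean_space \<Rightarrow> 'f \<times> 'f" where
  "cd_one one = (one, 0)"

lemma linear_conj: "linear (nda_conj one)"
  by (rule linearI) (simp_all add: nda_conj_def re_part_def inner_add algebra_simps)

lemma (in normed_division_algebra) normed_division_algebra_double:
  assumes assoc: "\<And>x y z. mul (mul x y) z = mul x (mul y z)"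
  shows "normed_division_algebra (cd_mul mul one) (cd_one one)"
proof
  show "bilinear (cd_mul mul one)"
    by (auto simp: bilinear_def cd_mul_def mul_simps algebra_simps
        linear_add[OF linear_conj] linear_scale[OF linear_conj] intro!: linearI)
  have c1: "nda_conj one one = one" and c0: "nda_conj one 0 = 0"
    by (simp_all add: nda_conj_def re_part_def one_inner_one scaleR_2)
  note z = bilinear_lzero[OF bilinear_mul] bilinear_rzero[OF bilinear_mul]
  show "cd_mul mul one (cd_one one) x = x" for x
    by (cases x) (simp add: cd_mul_def cd_one_def mul_one_left mul_one_right z)
  show "cd_mul mul one x (cd_one one) = x" for x
    by (cases x) (simp add: cd_mul_def cd_one_def mul_one_left mul_one_right z c1 c0)
  show "norm (cd_mul mul one x y) = norm x * norm y" for x y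
  proof -
    obtain a b c d where x: "x = (a, b)" and y: "y = (c, d)" by (cases x, cases y)
    have "mul a c \<bullet> mul (nda_conj one d) b = mul d (mul a c) \<bullet> b"
      using inner_mul_conj_left[of "nda_conj one d" b "mul a c"]
      by (simp add: conj_conj inner_commute)
    also have "\<dots> = mul d a \<bullet> mul b (nda_conj one c)"
      by (simp add: inner_mul_conj_right flip: assoc)
    finally have cross: "mul a c \<bullet> mul (nda_conj one d) b = mul d a \<bullet> mul b (nda_conj one c)" .
    have nc: "nda_conj one u \<bullet> nda_conj one u = u \<bullet> u" for u
      using norm_conj[of u] by (simp add: norm_eq)
    have "cd_mul mul one x y \<bullet> cd_mul mul one x y = (x \<bullet> x) * (y \<bullet> y)"
      by (simp add: x y cd_mul_def inner_diff inner_add inner_mul_same nc cross inner_commute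
          algebra_simps)
    then show ?thesis
      by (simp add: norm_eq_sqrt_inner real_sqrt_mult)
  qed
qed

definition quat_mul :: "complex \<times> complex \<Rightarrow> complex \<times> complex \<Rightarrow> complex \<times> complex" where
  "quat_mul = cd_mul (*) 1"

definition quat_one :: "complex \<times> complex" where
  "quat_one = cd_one 1"

interpretation quat_nda: normed_division_algebra quat_mul quat_one
  unfolding quat_mul_def quat_one_def
  by (rule complex_nda.normed_division_algebra_double) simp

lemma conj_complex: "nda_conj (1::complex) = cnj"
  by (auto simp: nda_conj_def re_part_def complex_eq_iff)

interpretation oct_nda: normed_division_algebra "cd_mul quat_mul quat_one" "cd_one quat_one"
  by (rule quat_nda.normed_division_algebra_double)
     (auto simp: quat_mul_def cd_mul_def conj_complex algebra_simps)

lemma "DIM(real) = 1" "DIM(complex) = 2" "DIM(complex \<times> complex) = 4"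
  "DIM((complex \<times> complex) \<times> (complex \<times> complex)) = 8"
  by simp_all

end

theory Submission
  imports Defs
begin

(* The map (s, y) \<mapsto> (s + |y|^2, (s + |y|^2)^(-1/2) y) is inverted by
   (s1, r) \<mapsto> (s1 (1 - |r|^2), s1^(1/2) r), so for fixed y one translates s, and then, for fixed s1,
   one scales y, with Jacobian s1^(d/2) where d = \<beta> m n. The exponents
   of the Gamma and the Gaussian density add up to - b s1, and the transformed joint density splits into
   a function of s1 times a function of r. The Gamma factor has total mass 1, hence so does the other. *)

section \<open>Gamma, Gaussian and Pearson type II densities on Euclidean spaces\<close>

section \<open>Densities\<close>

text \<open>Shape \<open>a\<close> and rate \<open>b\<close>: the law chi^{2,beta}(nu) is the case a
  = beta nu / 2, b = beta / 2.\<close>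

definition gamma_density :: "real \<Rightarrow> real \<Rightarrow> real \<Rightarrow> real" where
  "gamma_density a b s = (if s > 0 then b powr a / Gamma a * (s powr (a - 1) * exp (- b * s)) else 0)"

text \<open>The centred normal law with covariance I / (2 b); the standard matrix normal law is the
  case b = beta / 2.\<close>

definition gaussian_density :: "real \<Rightarrow> 'e::euclidean_space \<Rightarrow> real" where
  "gaussian_density b y = (b / pi) powr (real DIM('e) / 2) * exp (- b * (norm y)\<^sup>2)"

text \<open>The norm stands for the trace: \<open>tr_AAstar_eq\<close> identifies tr A A* with the
  squared Euclidean norm, so the argument can be run in any Euclidean space.\<close>

definition pearson2_density :: "real \<Rightarrow> 'e::euclidean_space \<Rightarrow> real" where
  "pearson2_density a r = (if 1 - (norm r)\<^sup>2 > 0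
     then Gamma (a + real DIM('e) / 2) / (pi powr (real DIM('e) / 2) * Gamma a)
       * (1 - (norm r)\<^sup>2) powr (a - 1)
     else 0)"

lemma gamma_density_measurable [measurable]: "gamma_density a b \<in> borel_measurable borel"
  unfolding gamma_density_def by measurable

lemma gaussian_density_measurable [measurable]:
  "(gaussian_density b :: 'e::euclidean_space \<Rightarrow> real) \<in> borel_measurable borel"
  unfolding gaussian_density_def by measurable

lemma pearson2_density_measurable [measurable]:
  "(pearson2_density a :: 'e::euclidean_space \<Rightarrow> real) \<in> borel_measurable borel"
  unfolding pearson2_density_def by measurable

lemma gamma_density_nonneg: "a > 0 \<Longrightarrow> gamma_density a b s \<ge> 0"
  by (simp add: gamma_density_def Gamma_real_pos less_imp_le)

text \<open>The substitution s = t / b turns the integral into Euler's integral for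
  \<open>Gamma a\<close>.\<close>

lemma nn_integral_gamma_density:
  assumes "a > 0" "b > 0"
  shows "(\<integral>\<^sup>+s. gamma_density a b s \<partial>lborel) = 1"
proof -
  have G: "Gamma a > 0" using assms by (simp add: Gamma_real_pos)
  have "(\<integral>\<^sup>+s. gamma_density a b s \<partial>lborel) = ennreal (1 / b) * (\<integral>\<^sup>+t. gamma_density a b (0 + 1 / b * t) \<partial>lborel)"
    using nn_integral_real_affine[of "\<lambda>s. ennreal (gamma_density a b s)" "1 / b" 0] assms by simp
  also have "\<dots> = (\<integral>\<^sup>+t. ennreal (1 / b) * ennreal (gamma_density a b (0 + 1 / b * t)) \<partial>lborel)"
    by (rule nn_integral_cmult[symmetric]) simp
  also have "\<dots> = (\<integral>\<^sup>+t. ennreal (1 / Gamma a) * ennreal (indicator {0..} t * t powr (a - 1) / exp t) \<partial>lborel)"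
  proof (rule nn_integral_cong_AE)
    show "AE t in lborel. ennreal (1 / b) * ennreal (gamma_density a b (0 + 1 / b * t))
      = ennreal (1 / Gamma a) * ennreal (indicator {0..} t * t powr (a - 1) / exp t)"
      \<comment> \<open>The conditions \<open>s > 0\<close> and \<open>{0..}\<close> differ only at
        t = 0, which is a null set.\<close>
      using AE_lborel_singleton[of "0::real"]
    proof eventually_elim
      case (elim t)
      have "1 / b * gamma_density a b (0 + 1 / b * t)
          = 1 / Gamma a * (indicator {0..} t * t powr (a - 1) / exp t)"
        using assms elim
        by (auto simp: gamma_density_def indicator_def powr_divide powr_diff exp_minus field_simps zero_less_divide_iff)
      then show ?case
        using assms G by (simp add: ennreal_mult'[symmetric])
    qed
  qed
  also have "\<dots> = ennreal (1 / Gamma a) * ennreal (Gamma a)"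
    using assms by (simp add: nn_integral_cmult Gamma_conv_nn_integral_real)
  also have "\<dots> = 1"
    using G by (simp add: ennreal_mult'[symmetric])
  finally show ?thesis .
qed

text \<open>Trades the existential constant of \<open>chi2_distributed\<close> for an explicit one,
  so that the hypothesis on \<open>S\<close> and the claim on \<open>S1\<close> both become
  statements about \<open>gamma_density\<close>.\<close>

lemma (in prob_space) chi2_distributed_iff_gamma_density:
  assumes "\<beta> > 0" "\<nu> > 0"
  shows "chi2_distributed M S \<beta> \<nu> \<longleftrightarrow>
    distributed M lborel S (gamma_density (real \<beta> * \<nu> / 2) (real \<beta> / 2))"
proof -
  define a b where "a = real \<beta> * \<nu> / 2" and "b = real \<beta> / 2"
  have pos: "a > 0" "b > 0" "Gamma a > 0" using assms by (auto simp: a_def b_def Gamma_real_pos)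
  define k where "k = b powr a / Gamma a"
  have k: "k > 0" using pos by (simp add: k_def)
  define f where "f c s = (if s > 0 then c * (s powr (real \<beta> * \<nu> / 2 - 1) * exp (- real \<beta> * s / 2)) else 0)"
    for c s :: real
  have f: "f c s = c / k * gamma_density a b s" for c s
    using k unfolding k_def[symmetric] f_def gamma_density_def by (simp add: k_def[symmetric] a_def b_def)
  (* total mass 1 determines the unspecified normalising constant *)
  have eq: "c = k" if c: "c > 0" and "distributed M lborel S (f c)" for c
  proof -
    interpret D: prob_space "density lborel (f c)"
      using that(2) prob_space_distr[of S lborel] by (simp add: distributed_def)
    have "1 = (\<integral>\<^sup>+s. f c s \<partial>lborel)"
      using D.emeasure_space_1 by (simp add: emeasure_density f)
    also have "\<dots> = ennreal (c / k) * (\<integral>\<^sup>+s. gamma_density a b s \<partial>lborel)"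
      using c k by (simp only: f ennreal_mult' divide_nonneg_nonneg less_imp_le)
        (simp add: nn_integral_cmult)
    finally show ?thesis
      using c k pos by (simp add: nn_integral_gamma_density)
  qed
  have "f k = gamma_density a b"
    using k by (simp add: f fun_eq_iff)
  with eq k have "(\<exists>c>0. distributed M lborel S (f c)) \<longleftrightarrow> distributed M lborel S (gamma_density a b)"
    by metis
  then show ?thesis
    by (simp add: chi2_distributed_def f_def a_def b_def)
qed

text \<open>With y = sqrt(s) r the Gamma argument s - |y|^2 is s (1 - |r|^2), and the two
  exponentials multiply to exp(-b s). The Jacobian s^(d/2) raises the remaining s^(a-1) to the power
  required by shape a + d/2, and b^(d/2) from the Gaussian constant completes b^(a + d/2).\<close>

lemma gamma_gaussian_density_factor:
  fixes r :: "'e::euclidean_space"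
  assumes "a > 0" "b > 0" "s > 0"
  shows "sqrt s ^ DIM('e) * (gamma_density a b (s - (norm (sqrt s *\<^sub>R r))\<^sup>2) * gaussian_density b (sqrt s *\<^sub>R r))
    = gamma_density (a + real DIM('e) / 2) b s * pearson2_density a r"
proof -
  let ?h = "real DIM('e) / 2"
  have n: "(norm (sqrt s *\<^sub>R r))\<^sup>2 = s * (norm r)\<^sup>2"
    using assms by (simp add: power_mult_distrib)
  have s: "s - s * (norm r)\<^sup>2 = s * (1 - (norm r)\<^sup>2)"
    by (simp add: algebra_simps)
  \<comment> \<open>This factor divides the Gamma density on the right and multiplies the Pearson
    density, so it has to be nonzero to cancel.\<close>
  have "Gamma (a + ?h) > 0"
    using assms by (simp add: Gamma_real_pos add_pos_nonneg)
  then have G: "Gamma (a + ?h) \<noteq> 0" by linarith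
  show ?thesis
  proof (cases "1 - (norm r)\<^sup>2 > 0")
    case True
    have e: "exp (- b * s) = exp (- b * (s * (1 - (norm r)\<^sup>2))) * exp (- b * (s * (norm r)\<^sup>2))"
      by (simp add: exp_add[symmetric] algebra_simps)
    have p: "sqrt s ^ DIM('e) = s powr ?h"
      using assms by (simp add: powr_half_sqrt[symmetric] powr_realpow[symmetric] powr_powr)
    have q: "s powr (a + ?h - 1) = s powr (a - 1) * s powr ?h"
      by (simp add: powr_add[symmetric] algebra_simps)
    have t: "(s * (1 - (norm r)\<^sup>2)) powr (a - 1) = s powr (a - 1) * (1 - (norm r)\<^sup>2) powr (a - 1)"
      using assms True by (simp add: powr_mult)
    have u: "(b / pi) powr ?h = b powr ?h / pi powr ?h"
      using assms by (simp add: powr_divide)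
    show ?thesis
      using assms True G
      unfolding gamma_density_def pearson2_density_def gaussian_density_def n s e p q t u powr_add[of b]
      by (simp add: mult_ac)
  next
    case False
    \<comment> \<open>For r outside the open unit ball the Gamma argument is not positive, so both
      sides are 0.\<close>
    then have "\<not> s * (1 - (norm r)\<^sup>2) > 0"
      using assms by (simp add: zero_less_mult_iff)
    then show ?thesis
      using False unfolding gamma_density_def pearson2_density_def n s by simp
  qed
qed

section \<open>Translation and scaling in the Gamma-Gaussian integral\<close>

section \<open>Change of variables\<close>

lemma nn_integral_lborel_scaleR:
  fixes f :: "'e::euclidean_space \<Rightarrow> ennreal"
  assumes [measurable]: "f \<in> borel_measurable borel" and c: "c > 0"
  shows "(\<integral>\<^sup>+y. f y \<partial>lborel) = (\<integral>\<^sup>+r. ennreal (c ^ DIM('e)) * f (c *\<^sub>R r) \<partial>lborel)"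
  using c by (subst lborel_affine[of c 0]) (simp_all add: nn_integral_density nn_integral_distr)

text \<open>The change of variables tested against an arbitrary nonnegative measurable
  \<open>f\<close>. On the left s is integrated innermost, so that the translation happens on the
  real line for fixed y; on the right r is innermost, so that the scaling happens for fixed
  s.\<close>

lemma nn_integral_gamma_gaussian:
  fixes f :: "real \<times> 'e::euclidean_space \<Rightarrow> ennreal"
  assumes [measurable]: "f \<in> borel_measurable (borel \<Otimes>\<^sub>M borel)" and ab: "a > 0" "b > 0"
  shows "(\<integral>\<^sup>+y. \<integral>\<^sup>+s. f (s + (norm y)\<^sup>2, (s + (norm y)\<^sup>2) powr (- 1 / 2) *\<^sub>R y)
        * (gamma_density a b s * gaussian_density b y) \<partial>lborel \<partial>lborel)
    = (\<integral>\<^sup>+s. \<integral>\<^sup>+r. f (s, r)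
        * (gamma_density (a + real DIM('e) / 2) b s * pearson2_density a r) \<partial>lborel \<partial>lborel)"
    (is "?lhs = ?rhs")
proof -
  \<comment> \<open>The integrand after translation: \<open>s\<close> now denotes the former s +
    |y|^2, which is the value of \<open>S1\<close>.\<close>
  let ?g = "\<lambda>s y. f (s, s powr (- 1 / 2) *\<^sub>R y) * ennreal (gamma_density a b (s - (norm y)\<^sup>2) * gaussian_density b y)"
  have "?lhs = (\<integral>\<^sup>+y. \<integral>\<^sup>+s. ?g s y \<partial>lborel \<partial>lborel)"
  proof (rule nn_integral_cong)
    fix y :: 'e
    show "(\<integral>\<^sup>+s. f (s + (norm y)\<^sup>2, (s + (norm y)\<^sup>2) powr (- 1 / 2) *\<^sub>R y)
        * (gamma_density a b s * gaussian_density b y) \<partial>lborel) = (\<integral>\<^sup>+s. ?g s y \<partial>lborel)"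
      using nn_integral_real_affine[of "\<lambda>s. ?g s y" 1 "(norm y)\<^sup>2"] by (simp add: add.commute)
  qed
  also have "\<dots> = (\<integral>\<^sup>+s. \<integral>\<^sup>+y. ?g s y \<partial>lborel \<partial>lborel)"
    by (rule lborel_pair.Fubini') measurable
  also have "\<dots> = ?rhs"
  proof (rule nn_integral_cong)
    fix s :: real
    show "(\<integral>\<^sup>+y. ?g s y \<partial>lborel) = (\<integral>\<^sup>+r. f (s, r)
        * (gamma_density (a + real DIM('e) / 2) b s * pearson2_density a r) \<partial>lborel)"
    proof (cases "s > 0")
      case True
      have "(\<integral>\<^sup>+y. ?g s y \<partial>lborel) = (\<integral>\<^sup>+r. ennreal (sqrt s ^ DIM('e)) * ?g s (sqrt s *\<^sub>R r) \<partial>lborel)"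
        using True by (intro nn_integral_lborel_scaleR) simp_all
      also have "\<dots> = (\<integral>\<^sup>+r. f (s, r)
        * (gamma_density (a + real DIM('e) / 2) b s * pearson2_density a r) \<partial>lborel)"
      proof (rule nn_integral_cong)
        fix r :: 'e
        have 1: "s powr (- 1 / 2) *\<^sub>R (sqrt s *\<^sub>R r) = r"
          using True by (simp add: powr_half_sqrt[symmetric] powr_add[symmetric])
        show "ennreal (sqrt s ^ DIM('e)) * ?g s (sqrt s *\<^sub>R r)
          = f (s, r) * (gamma_density (a + real DIM('e) / 2) b s * pearson2_density a r)"
          unfolding 1 gamma_gaussian_density_factor[OF ab True, symmetric]
          using True by (simp add: ennreal_mult' mult.left_commute)
      qed
      finally show ?thesis .
    next
      case False
      \<comment> \<open>Scaling by sqrt(s) requires s > 0; for the other s both Gamma densities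
        vanish.\<close>
      then have "\<not> s - (norm y)\<^sup>2 > 0" for y :: 'e
        using zero_le_power2[of "norm y"] by linarith
      with False show ?thesis
        by (simp add: gamma_density_def)
    qed
  qed
  finally show ?thesis .
qed

section \<open>Independence and product densities\<close>

section \<open>Independence\<close>

text \<open>Independence fixes the joint law on measurable rectangles, and these determine a product
  of sigma-finite measures. \<open>L1\<close>, \<open>L2\<close> are the reference measures of the
  densities, \<open>N1\<close>, \<open>N2\<close> only supply the sigma-algebras; in the application
  these are \<open>lborel\<close> and \<open>borel\<close>.\<close>

lemma (in prob_space) distributed_pair_of_independent_rvs:
  assumes ind: "independent_rvs M N1 X1 N2 X2"
    and "sigma_finite_measure L1" "sigma_finite_measure L2"
    and [measurable_cong]: "sets L1 = sets N1" "sets L2 = sets N2"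
    and D: "distributed M L1 X1 f1" "distributed M L2 X2 f2"
  shows "distributed M (L1 \<Otimes>\<^sub>M L2) (\<lambda>x. (X1 x, X2 x)) (\<lambda>(x, y). f1 x * f2 y)"
proof (rule distributed_joint_indep')
  have [measurable]: "X1 \<in> measurable M L1" "X2 \<in> measurable M L2"
    using D by (auto simp: distributed_def)
  show "distr M L1 X1 \<Otimes>\<^sub>M distr M L2 X2 = distr M (L1 \<Otimes>\<^sub>M L2) (\<lambda>x. (X1 x, X2 x))"
  proof (rule pair_measure_eqI)
    show "sigma_finite_measure (distr M L1 X1)" "sigma_finite_measure (distr M L2 X2)"
      by (auto intro!: prob_space_imp_sigma_finite prob_space_distr)
    fix A B assume "A \<in> sets (distr M L1 X1)" "B \<in> sets (distr M L2 X2)"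
    then have AB [measurable]: "A \<in> sets L1" "B \<in> sets L2" by auto
    then have "prob ((X1 -` A \<inter> space M) \<inter> (X2 -` B \<inter> space M))
      = prob (X1 -` A \<inter> space M) * prob (X2 -` B \<inter> space M)"
      using ind assms(4,5) unfolding independent_rvs_def by (intro indep_setD) auto
    moreover have "(\<lambda>x. (X1 x, X2 x)) -` (A \<times> B) \<inter> space M = (X1 -` A \<inter> space M) \<inter> (X2 -` B \<inter> space M)"
      by auto
    ultimately show "emeasure (distr M L1 X1) A * emeasure (distr M L2 X2) B =
      emeasure (distr M (L1 \<Otimes>\<^sub>M L2) (\<lambda>x. (X1 x, X2 x))) (A \<times> B)"
      by (simp add: emeasure_distr emeasure_eq_measure ennreal_mult)
  qed simp
qed fact+

text \<open>By Tonelli the joint law of a rectangle is a product of two integrals. Taking the whole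
  space for one side, where the integral is 1, yields the marginal densities; the rectangle formula
  then says that the variables are independent.\<close>

lemma (in prob_space) independent_rvs_of_product_density:
  assumes sf: "sigma_finite_measure L1" "sigma_finite_measure L2"
    and [measurable_cong]: "sets L1 = sets N1" "sets L2 = sets N2"
    and [measurable]: "f1 \<in> borel_measurable L1" "f2 \<in> borel_measurable L2"
    and D: "distributed M (L1 \<Otimes>\<^sub>M L2) (\<lambda>x. (X1 x, X2 x)) (\<lambda>(x, y). f1 x * f2 y)"
    and one: "(\<integral>\<^sup>+x. f1 x \<partial>L1) = 1" "(\<integral>\<^sup>+y. f2 y \<partial>L2) = 1"
  shows "distributed M L1 X1 f1" "distributed M L2 X2 f2" "independent_rvs M N1 X1 N2 X2"
proof -
  interpret L1: sigma_finite_measure L1 by fact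
  interpret L2: sigma_finite_measure L2 by fact
  interpret pair_sigma_finite L1 L2 ..
  note pair_meas = distributed_measurable[OF D]
  have X [measurable]: "X1 \<in> measurable M L1" "X2 \<in> measurable M L2"
    using measurable_compose[OF pair_meas measurable_fst] measurable_compose[OF pair_meas measurable_snd]
    by simp_all
  have eq: "emeasure M ((X1 -` A \<inter> space M) \<inter> (X2 -` B \<inter> space M))
      = (\<integral>\<^sup>+x. f1 x * indicator A x \<partial>L1) * (\<integral>\<^sup>+y. f2 y * indicator B y \<partial>L2)"
    if [measurable]: "A \<in> sets L1" "B \<in> sets L2" for A B
  proof -
    have "emeasure M ((X1 -` A \<inter> space M) \<inter> (X2 -` B \<inter> space M))
      = emeasure M ((\<lambda>x. (X1 x, X2 x)) -` (A \<times> B) \<inter> space M)"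
      by (intro arg_cong[where f = "emeasure M"]) auto
    also have "\<dots> = (\<integral>\<^sup>+z. (case z of (x, y) \<Rightarrow> f1 x * f2 y) * indicator (A \<times> B) z \<partial>(L1 \<Otimes>\<^sub>M L2))"
      by (rule distributed_emeasure[OF D]) measurable
    also have "\<dots> = (\<integral>\<^sup>+x. \<integral>\<^sup>+y. (f1 x * indicator A x) * (f2 y * indicator B y) \<partial>L2 \<partial>L1)"
      by (subst L2.nn_integral_fst[symmetric]) (auto intro!: nn_integral_cong simp: indicator_def)
    also have "\<dots> = (\<integral>\<^sup>+x. f1 x * indicator A x \<partial>L1) * (\<integral>\<^sup>+y. f2 y * indicator B y \<partial>L2)"
      by (simp add: nn_integral_cmult nn_integral_multc)
    finally show ?thesis .
  qed
  have sp: "X1 -` space L1 \<inter> space M = space M" "X2 -` space L2 \<inter> space M = space M"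
    using measurable_space[of X1 M L1] measurable_space[of X2 M L2] by auto
  have eq1: "emeasure M (X1 -` A \<inter> space M) = (\<integral>\<^sup>+x. f1 x * indicator A x \<partial>L1)" if "A \<in> sets L1" for A
    using eq[OF that sets.top] by (simp add: sp Int_absorb2 one)
  have eq2: "emeasure M (X2 -` B \<inter> space M) = (\<integral>\<^sup>+y. f2 y * indicator B y \<partial>L2)" if "B \<in> sets L2" for B
    using eq[OF sets.top that] by (simp add: sp Int_absorb1 one)
  show "distributed M L1 X1 f1"
    unfolding distributed_def by (auto intro!: measure_eqI simp: emeasure_distr emeasure_density eq1)
  show "distributed M L2 X2 f2"
    unfolding distributed_def by (auto intro!: measure_eqI simp: emeasure_distr emeasure_density eq2)
  have "prob ((X1 -` A \<inter> space M) \<inter> (X2 -` B \<inter> space M)) = prob (X1 -` A \<inter> space M) * prob (X2 -` B \<inter> space M)"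
    if "A \<in> sets L1" "B \<in> sets L2" for A B
    using eq[OF that] eq1[OF that(1)] eq2[OF that(2)]
    by (simp add: measure_def enn2real_mult)
  moreover have "X1 \<in> measurable M N1" "X2 \<in> measurable M N2"
    using X measurable_cong_sets[OF refl assms(3)] measurable_cong_sets[OF refl assms(4)] by blast+
  ultimately show "independent_rvs M N1 X1 N2 X2"
    unfolding independent_rvs_def using assms(3,4)
    by (auto intro!: indep_setI measurable_sets)
qed

section \<open>Joint law of the squared radius and the normalised vector\<close>

section \<open>The decomposition\<close>

text \<open>The theorem for a Gaussian vector in any Euclidean space: the joint density of
  \<open>S1\<close> and \<open>R1\<close> is computed and found to be a product.\<close>

lemma (in prob_space) gamma_gaussian_decomposition:
  fixes Y :: "'a \<Rightarrow> 'e::euclidean_space"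
  assumes ab: "a > 0" "b > 0"
    and S: "distributed M lborel S (gamma_density a b)"
    and Y: "distributed M lborel Y (gaussian_density b)"
    and ind: "independent_rvs M borel S borel Y"
  defines "S1 \<equiv> (\<lambda>x. S x + (norm (Y x))\<^sup>2)"
  defines "R1 \<equiv> (\<lambda>x. S1 x powr (- 1 / 2) *\<^sub>R Y x)"
  shows "distributed M lborel S1 (gamma_density (a + real DIM('e) / 2) b)"
    and "independent_rvs M borel S1 borel R1"
    and "distributed M lborel R1 (pearson2_density a)"
proof -
  let ?L = "lborel \<Otimes>\<^sub>M lborel :: (real \<times> 'e) measure"
  let ?p = "\<lambda>(s, y). ennreal (gamma_density a b s) * ennreal (gaussian_density b y)"
  let ?q = "\<lambda>(s, r::'e). ennreal (gamma_density (a + real DIM('e) / 2) b s) * ennreal (pearson2_density a r)"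
  have SY: "distributed M ?L (\<lambda>x. (S x, Y x)) ?p"
    by (rule distributed_pair_of_independent_rvs[OF ind])
       (use S Y in \<open>auto intro: lborel.sigma_finite_measure_axioms\<close>)
  have [measurable]: "S \<in> borel_measurable M" "Y \<in> borel_measurable M"
    using ind by (auto simp: independent_rvs_def)
  have [measurable]: "S1 \<in> borel_measurable M" "R1 \<in> borel_measurable M"
    unfolding S1_def R1_def by measurable
  have mass1: "(\<integral>\<^sup>+s. gamma_density (a + real DIM('e) / 2) b s \<partial>lborel) = 1"
    using ab by (intro nn_integral_gamma_density) (auto intro: add_pos_nonneg)
  have law: "emeasure M ((\<lambda>x. (S1 x, R1 x)) -` C \<inter> space M) = (\<integral>\<^sup>+z. ?q z * indicator C z \<partial>?L)"
    if [measurable]: "C \<in> sets ?L" for C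
  proof -
    have [measurable]: "C \<in> sets (borel \<Otimes>\<^sub>M borel)"
      using that by (simp cong: sets_pair_measure_cong)
    let ?T = "\<lambda>(s, y::'e). (s + (norm y)\<^sup>2, (s + (norm y)\<^sup>2) powr (- 1 / 2) *\<^sub>R y)"
    \<comment> \<open>Pulling \<open>C\<close> back along the transformation expresses the event
      through \<open>S\<close> and \<open>Y\<close>, whose joint density is known.\<close>
    let ?D = "?T -` C \<inter> space ?L"
    have [measurable]: "?T \<in> measurable ?L ?L" by measurable
    have "(\<lambda>x. (S1 x, R1 x)) -` C \<inter> space M = (\<lambda>x. (S x, Y x)) -` ?D \<inter> space M"
      by (auto simp: S1_def R1_def space_pair_measure)
    then have "emeasure M ((\<lambda>x. (S1 x, R1 x)) -` C \<inter> space M) = (\<integral>\<^sup>+z. ?p z * indicator ?D z \<partial>?L)"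
      by (simp only:) (rule distributed_emeasure[OF SY], measurable)
    also have "\<dots> = (\<integral>\<^sup>+z. indicator C (?T z) * ?p z \<partial>?L)"
      by (intro nn_integral_cong) (auto simp: indicator_def space_pair_measure)
    \<comment> \<open>The integral over y is placed outside, as
      \<open>nn_integral_gamma_gaussian\<close> expects.\<close>
    also have "\<dots> = (\<integral>\<^sup>+y. \<integral>\<^sup>+s. indicator C (?T (s, y)) * ?p (s, y) \<partial>lborel \<partial>lborel)"
      by (rule lborel_pair.nn_integral_snd[symmetric]) measurable
    also have "\<dots> = (\<integral>\<^sup>+s. \<integral>\<^sup>+r. indicator C (s, r) * ?q (s, r) \<partial>lborel \<partial>lborel)"
      using nn_integral_gamma_gaussian[of "indicator C" a b] ab
      by (simp add: ennreal_mult' gamma_density_nonneg)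
    also have "\<dots> = (\<integral>\<^sup>+z. indicator C z * ?q z \<partial>?L)"
      by (rule lborel.nn_integral_fst) measurable
    finally show ?thesis by (simp add: mult.commute)
  qed
  have joint: "distributed M ?L (\<lambda>x. (S1 x, R1 x)) ?q"
    unfolding distributed_def by (auto intro!: measure_eqI simp: emeasure_distr emeasure_density law)
  \<comment> \<open>The normalisation of the Pearson density is read off from the total mass of the
    joint law, so no Beta integral has to be evaluated.\<close>
  have "1 = (\<integral>\<^sup>+z. ?q z \<partial>?L)"
    using law[OF sets.top] by (simp add: space_pair_measure emeasure_space_1)
  also have "\<dots> = (\<integral>\<^sup>+s. \<integral>\<^sup>+r. ?q (s, r) \<partial>lborel \<partial>lborel)"
    by (rule lborel.nn_integral_fst[symmetric]) measurable
  also have "\<dots> = (\<integral>\<^sup>+r. pearson2_density a (r::'e) \<partial>lborel)"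
    by (simp add: nn_integral_cmult nn_integral_multc mass1)
  finally have mass2: "(\<integral>\<^sup>+r. pearson2_density a (r::'e) \<partial>lborel) = 1" ..
  note concl = independent_rvs_of_product_density[OF _ _ _ _ _ _ joint mass1 mass2]
  show "distributed M lborel S1 (gamma_density (a + real DIM('e) / 2) b)"
    by (rule concl(1)) (auto intro: lborel.sigma_finite_measure_axioms)
  show "distributed M lborel R1 (pearson2_density a)"
    by (rule concl(2)) (auto intro: lborel.sigma_finite_measure_axioms)
  show "independent_rvs M borel S1 borel R1"
    by (rule concl(3)) (auto intro: lborel.sigma_finite_measure_axioms)
qed

text \<open>Instance of \<open>gamma_gaussian_decomposition\<close> on the matrix space, whose real
  dimension is beta m n, with the trace rewritten as the squared norm.\<close>

theorem theorem4p1: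
  fixes mul :: "'f::euclidean_space \<Rightarrow> 'f \<Rightarrow> 'f" and one :: 'f
    and \<beta> :: nat and \<nu> :: real
    and M :: "'a measure"
    and S S1 :: "'a \<Rightarrow> real"
    and Y R1 :: "'a \<Rightarrow> 'f^'n^'m"
  assumes "normed_division_algebra mul one"
    and "\<beta> = DIM('f)" and "\<beta> \<in> {1, 2, 4, 8}"
    and "\<nu> > 0"
    and "prob_space M"
    and "\<And>\<omega>. \<omega> \<in> space M \<Longrightarrow> S \<omega> > 0"
    and "chi2_distributed M S \<beta> \<nu>"
    and "std_matrix_normal_distributed mul one M Y"
    and "independent_rvs M borel S borel Y"
    and "S1 = (\<lambda>\<omega>. S \<omega> + tr_AAstar mul one (Y \<omega>))"
    and "R1 = (\<lambda>\<omega>. (S1 \<omega> powr (- 1 / 2)) *\<^sub>R Y \<omega>)"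
  shows "chi2_distributed M S1 \<beta> (\<nu> + real CARD('m) * real CARD('n)) \<and>
    independent_rvs M borel S1 borel R1 \<and>
    distributed M lborel R1 (\<lambda>R. ennreal
      (if 1 - tr_AAstar mul one R > 0
       then Gamma (real \<beta> * (\<nu> + real CARD('m) * real CARD('n)) / 2)
              / (pi powr (real \<beta> * real CARD('m) * real CARD('n) / 2) * Gamma (real \<beta> * \<nu> / 2))
            * (1 - tr_AAstar mul one R) powr (real \<beta> * \<nu> / 2 - 1)
       else 0))"
proof -
  interpret normed_division_algebra mul one by fact
  interpret prob_space M by fact
  define a b where "a = real \<beta> * \<nu> / 2" and "b = real \<beta> / 2"
  have \<beta>: "\<beta> > 0" using assms(3) by auto
  then have ab: "a > 0" "b > 0" using assms(4) by (auto simp: a_def b_def)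
  have dim: "real DIM('f^'n^'m) = real \<beta> * real CARD('m) * real CARD('n)"
    by (simp add: assms(2))
  \<comment> \<open>Adding half the dimension to the shape raises the degrees of freedom from nu to
    nu + m n.\<close>
  have shape: "real \<beta> * (\<nu> + real CARD('m) * real CARD('n)) / 2 = a + real DIM('f^'n^'m) / 2"
    unfolding dim a_def by (simp add: field_simps)
  have S: "distributed M lborel S (gamma_density a b)"
    using assms(7) chi2_distributed_iff_gamma_density[OF \<beta> assms(4)] by (simp add: a_def b_def)
  have "(2 * pi * \<beta> powr - 1) powr (- real \<beta> * CARD('m) * CARD('n) / 2) = (b / pi) powr (real DIM('f^'n^'m) / 2)"
  proof -
    \<comment> \<open>Since b = beta / 2, the base 2 pi / beta is pi / b, and the negative exponent
      inverts it.\<close>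
    have "2 * pi * \<beta> powr - 1 = inverse (b / pi)"
      using \<beta> by (simp add: b_def powr_minus field_simps)
    then show ?thesis
      unfolding dim using ab by (simp add: powr_minus powr_divide)
  qed
  then have Y: "distributed M lborel Y (gaussian_density b)"
    using assms(8) unfolding std_matrix_normal_distributed_def gaussian_density_def Let_def
    by (simp add: tr_AAstar_eq assms(2)[symmetric] b_def)
  have S1: "S1 = (\<lambda>\<omega>. S \<omega> + (norm (Y \<omega>))\<^sup>2)"
    by (simp add: assms(10) tr_AAstar_eq)
  have R1: "R1 = (\<lambda>\<omega>. (S \<omega> + (norm (Y \<omega>))\<^sup>2) powr (- 1 / 2) *\<^sub>R Y \<omega>)"
    by (simp add: assms(11) S1)
  note concl = gamma_gaussian_decomposition[OF ab S Y assms(9), folded S1 R1]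
  have "chi2_distributed M S1 \<beta> (\<nu> + real CARD('m) * real CARD('n))"
    using concl(1) assms(4) \<beta>
    by (simp only: chi2_distributed_iff_gamma_density[OF \<beta> add_pos_nonneg] shape b_def of_nat_0_le_iff mult_nonneg_nonneg)
  moreover have "distributed M lborel R1 (\<lambda>R. ennreal
      (if 1 - tr_AAstar mul one R > 0
       then Gamma (real \<beta> * (\<nu> + real CARD('m) * real CARD('n)) / 2)
              / (pi powr (real \<beta> * real CARD('m) * real CARD('n) / 2) * Gamma (real \<beta> * \<nu> / 2))
            * (1 - tr_AAstar mul one R) powr (real \<beta> * \<nu> / 2 - 1)
       else 0))"
    using concl(3) unfolding shape dim[symmetric] a_def[symmetric] tr_AAstar_eq pearson2_density_def .
  ultimately show ?thesis
    using concl(2) by blast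
qed

end
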